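(* Let $n\ge 2$. Suppose that in the No-Flippancy game with strings of length $n$ over $\{\mathrm{H},\mathrm{T}\}$ one of the two players (Alice or Bob) has the alternating string $\mathrm{HTHTHT}\cdots$ of length $n$ starting with $\mathrm{H}$, and the other player has a string that starts with $\mathrm{TT}$. Then the player with the alternating string wins.
   Context: No-Flippancy game: Alice and Bob have distinct strings $A=A_1\cdots A_n$ and $B=B_1\cdots B_n$ of the same length $n$ over the alphabet $\{\mathrm{H},\mathrm{T}\}$. Starting from the empty sequence, the players alternate turns, Alice going first, and on each turn the current player appends one letter to the sequence (the game output) as follows: let $i<n$ be the maximal length of a suffix of the current sequence that coincides with a prefix of the current player's string ($i=0$ is allowed, via the empty suffix); the player appends the letter with index $i+1$ of their own string. The game ends as soon as $A$ or $B$ appears as a block of consecutive letters in the sequence (necessarily as its suffix, no matter who made the last move); the player whose string appears first wins. If neither string ever appears, the game is infinite. A string is alternating if any two consecutive letters are different. *)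

theory Defs
  imports Main "HOL-Library.Sublist"
begin

datatype coin = H | T

definition alternating :: "coin list \<Rightarrow> bool" where
  "alternating X \<longleftrightarrow> successively (\<noteq>) X"

text \<open>
  The length of the longest suffix of the current sequence \<open>S\<close> that is a proper prefix of \<open>X\<close>.
  For nonempty \<open>X\<close> the set below is finite and contains \<open>0\<close>.
\<close>
definition overlap :: "coin list \<Rightarrow> coin list \<Rightarrow> nat" where
  "overlap S X = Max {i. i < length X \<and> suffix (take i X) S}"

text \<open>With 0-based indexing, the letter number \<open>i + 1\<close> of \<open>X\<close> is \<open>X ! i\<close>.\<close>
definition next_letter :: "coin list \<Rightarrow> coin list \<Rightarrow> coin" where
  "next_letter S X = X ! overlap S X"

text \<open>
  Note that \<open>sublist\<close> means a contiguous block, not a subsequence.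
\<close>
definition game_over :: "coin list \<Rightarrow> coin list \<Rightarrow> coin list \<Rightarrow> bool" where
  "game_over A B S \<longleftrightarrow> sublist A S \<or> sublist B S"

text \<open>
  \<open>game_output A B k\<close> is the sequence after \<open>k\<close> turns, where Alice has \<open>A\<close> and Bob has \<open>B\<close>;
  it stays constant once the game has ended. Alice moves when the current length is even.
\<close>
fun game_output :: "coin list \<Rightarrow> coin list \<Rightarrow> nat \<Rightarrow> coin list" where
  "game_output A B 0 = []"
| "game_output A B (Suc k) =
    (let S = game_output A B k in
     if game_over A B S then S
     else S @ [next_letter S (if even (length S) then A else B)])"

definition alice_wins :: "coin list \<Rightarrow> coin list \<Rightarrow> bool" where
  "alice_wins A B \<longleftrightarrow>
    (\<exists>k. sublist A (game_output A B k) \<and> (\<forall>j\<le>k. \<not> sublist B (game_output A B j)))"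

definition bob_wins :: "coin list \<Rightarrow> coin list \<Rightarrow> bool" where
  "bob_wins A B \<longleftrightarrow>
    (\<exists>k. sublist B (game_output A B k) \<and> (\<forall>j\<le>k. \<not> sublist A (game_output A B j)))"

end

theory Submission
  imports Defs
begin

text \<open>
  As long as \<open>TT\<close> has not occurred, a player whose string starts with \<open>TT\<close> plays \<open>T\<close> after every
  \<open>H\<close>, while the player with the alternating string plays \<open>H\<close> after every \<open>T\<close>. Hence the output is
  alternating, \<open>TT\<close> never occurs, and the alternating string appears after \<open>n\<close> turns if its owner
  starts, and after \<open>n + 1\<close> turns otherwise.
\<close>

text \<open>Both orders of the letters are needed: the output is \<open>zigzag H T\<close> when
  Alice owns the alternating string and \<open>zigzag T H\<close> when Bob does.\<close>

definition zigzag :: "'a \<Rightarrow> 'a \<Rightarrow> nat \<Rightarrow> 'a list" where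
  "zigzag a b k = map (\<lambda>i. if even i then a else b) [0..<k]"

lemma zigzag_0 [simp]: "zigzag a b 0 = []"
  and length_zigzag [simp]: "length (zigzag a b k) = k"
  and zigzag_eq_Nil_iff [simp]: "zigzag a b k = [] \<longleftrightarrow> k = 0"
  by (simp_all add: zigzag_def)

lemma zigzag_Suc: "zigzag a b (Suc k) = zigzag a b k @ [if even k then a else b]"
  by (simp add: zigzag_def)

lemma zigzag_Suc_Cons: "zigzag a b (Suc k) = a # zigzag b a k"
  by (induction k) (simp_all add: zigzag_Suc)

lemma last_zigzag: "k > 0 \<Longrightarrow> last (zigzag a b k) = (if even k then b else a)"
  by (cases k) (simp_all add: zigzag_Suc)

lemma successively_zigzag: "a \<noteq> b \<Longrightarrow> successively (\<noteq>) (zigzag a b k)"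
  by (simp add: successively_conv_nth zigzag_def)

lemma alternating_eq_zigzag:
  assumes "alternating X" and "prefix [H] X"
  shows "X = zigzag H T (length X)"
proof -
  have alt: "X ! i \<noteq> X ! Suc i" if "Suc i < length X" for i
    using assms(1) that by (simp add: alternating_def successively_conv_nth)
  have "X ! i = (if even i then H else T)" if "i < length X" for i
    using that
  proof (induction i)
    case 0
    then show ?case using assms(2) by (auto simp: prefix_def)
  next
    case (Suc i)
    then show ?case using alt[of i] by (cases "X ! Suc i") (auto split: if_splits)
  qed
  then show ?thesis by (intro nth_equalityI) (auto simp: zigzag_def)
qed

lemma overlap_less: "X \<noteq> [] \<Longrightarrow> overlap S X < length X"
  and overlap_suffix: "X \<noteq> [] \<Longrightarrow> suffix (take (overlap S X) X) S"
proof -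
  let ?I = "{i. i < length X \<and> suffix (take i X) S}"
  assume "X \<noteq> []"
  then have "0 \<in> ?I" by simp
  moreover have "finite ?I" by simp
  ultimately have "overlap S X \<in> ?I"
    unfolding overlap_def by (intro Max_in) blast+
  then show "overlap S X < length X" and "suffix (take (overlap S X) X) S" by auto
qed

text \<open>Used twice: it bounds the overlap of a string starting with \<open>TT\<close>, and it
  shows that this string never occurs in an alternating output.\<close>

lemma no_repeat_sublist:
  assumes "successively (\<noteq>) S" and "sublist Y S"
  shows "\<not> prefix [c, c] Y"
  using assms by (auto simp: prefix_def sublist_def successively_append_iff)

text \<open>An overlap of 2 or more would put the block \<open>TT\<close> into the alternating
  sequence \<open>S\<close>. So the overlap is 0 or 1, and \<open>X\<close> has \<open>T\<close> at
  both of these indices.\<close>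

lemma next_letter_TT:
  assumes "prefix [T, T] X" and alt: "successively (\<noteq>) S" and last: "S \<noteq> [] \<Longrightarrow> last S = H"
  shows "next_letter S X = T"
proof -
  from assms(1) obtain X' where X: "X = T # T # X'" by (auto simp: prefix_def)
  let ?i = "overlap S X"
  have suf: "suffix (take ?i X) S" by (rule overlap_suffix) (simp add: X)
  have "?i < 2"
  proof (rule ccontr)
    assume "\<not> ?i < 2"
    then obtain j where "?i = Suc (Suc j)" by (metis Suc_1 add_2_eq_Suc le_Suc_ex not_less)
    then have "prefix [T, T] (take ?i X)" by (simp add: X)
    with no_repeat_sublist[OF alt] suf show False by blast
  qed
  then show ?thesis by (auto simp: next_letter_def X less_2_cases_iff)
qed

text \<open>A parity argument: prefixes of odd length end in \<open>H\<close>, so none of them is a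
  suffix of \<open>S\<close>. The overlap is therefore even, and \<open>H\<close> stands at the even
  indices.\<close>

lemma next_letter_alternating:
  assumes "n > 0" and last: "S \<noteq> [] \<Longrightarrow> last S = T"
  shows "next_letter S (zigzag H T n) = H"
proof -
  let ?X = "zigzag H T n" and ?i = "overlap S (zigzag H T n)"
  have ne: "?X \<noteq> []" using assms(1) by simp
  have less: "?i < n" using overlap_less[OF ne] by simp
  have take: "take ?i ?X = zigzag H T ?i"
    using less by (simp add: zigzag_def take_map)
  have "even ?i"
  proof (rule ccontr)
    assume odd: "odd ?i"
    then have pos: "?i > 0" by (rule odd_pos)
    obtain Y where "S = Y @ zigzag H T ?i"
      using overlap_suffix[OF ne, of S] take by (auto simp: suffix_def)
    moreover have "zigzag H T ?i \<noteq> []" using pos by simp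
    ultimately have "last S = last (zigzag H T ?i) \<and> S \<noteq> []"
      by (metis append_is_Nil_conv last_append)
    then show False using last last_zigzag[OF pos, of H T] odd by simp
  qed
  then show ?thesis using less by (simp add: next_letter_def zigzag_def)
qed

text \<open>Reduces following the game to two checks on an explicit sequence, made for each length
  below \<open>m\<close>: the game is still running, and the player to move continues the
  pattern.\<close>

lemma game_output_zigzag:
  assumes "\<And>k. k < m \<Longrightarrow> \<not> game_over A B (zigzag a b k)"
    and "\<And>k. k < m \<Longrightarrow>
      next_letter (zigzag a b k) (if even k then A else B) = (if even k then a else b)"
    and "k \<le> m"
  shows "game_output A B k = zigzag a b k"
  using assms(3)
proof (induction k)
  case (Suc k)
  then show ?case using assms(1)[of k] assms(2)[of k] by (simp add: Let_def zigzag_Suc)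
qed simp

lemma alternating_alice_wins:
  assumes "n > 0" and "prefix [T, T] B"
  shows "alice_wins (zigzag H T n) B"
proof -
  have noB: "\<not> sublist B (zigzag H T k)" for k
    using no_repeat_sublist successively_zigzag assms(2) by (metis coin.distinct(1))
  have out: "game_output (zigzag H T n) B k = zigzag H T k" if "k \<le> n" for k
  proof (rule game_output_zigzag[OF _ _ that])
    fix k assume "k < n"
    then show "\<not> game_over (zigzag H T n) B (zigzag H T k)"
      \<comment> \<open>With fewer than \<open>n\<close> letters the output is too short to contain
        Alice's string.\<close>
      using noB by (auto simp: game_over_def dest: sublist_length_le)
    have "next_letter (zigzag H T k) (zigzag H T n) = H" if "even k"
      using that assms(1) by (intro next_letter_alternating) (auto simp: last_zigzag)
    moreover have "next_letter (zigzag H T k) B = T" if "odd k"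
      using that assms(2) odd_pos[OF that]
      by (intro next_letter_TT) (auto simp: last_zigzag successively_zigzag)
    ultimately show "next_letter (zigzag H T k) (if even k then zigzag H T n else B)
        = (if even k then H else T)" by simp
  qed
  show ?thesis unfolding alice_wins_def using out noB by (intro exI[of _ n]) auto
qed

lemma alternating_bob_wins:
  assumes "n > 0" and "prefix [T, T] A"
  shows "bob_wins A (zigzag H T n)"
proof -
  have noA: "\<not> sublist A (zigzag T H k)" for k
    using no_repeat_sublist successively_zigzag assms(2) by (metis coin.distinct(1))
  \<comment> \<open>Up to length \<open>n\<close>, containing Bob's string would force equality with
    it, but the output begins with \<open>T\<close> and the string with \<open>H\<close>.\<close>
  have early: "\<not> sublist (zigzag H T n) (zigzag T H k)" if "k < Suc n" for k
  proof
    assume sub: "sublist (zigzag H T n) (zigzag T H k)"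
    then have "k = n" using that sublist_length_le[OF sub] by simp
    from sub obtain us vs where eq: "zigzag T H k = us @ zigzag H T n @ vs"
      by (auto simp: sublist_def)
    from arg_cong[OF eq, of length] have "us = []" "vs = []" using \<open>k = n\<close> by auto
    then have "zigzag T H n = zigzag H T n" using eq \<open>k = n\<close> by simp
    then show False using assms(1) by (auto simp: gr0_conv_Suc zigzag_Suc_Cons)
  qed
  have out: "game_output A (zigzag H T n) k = zigzag T H k" if "k \<le> Suc n" for k
  proof (rule game_output_zigzag[OF _ _ that])
    fix k assume k: "k < Suc n"
    show "\<not> game_over A (zigzag H T n) (zigzag T H k)"
      using noA early[OF k] by (simp add: game_over_def)
    have "next_letter (zigzag T H k) (zigzag H T n) = H" if "odd k"
      using that assms(1) odd_pos[OF that]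
      by (intro next_letter_alternating) (auto simp: last_zigzag)
    moreover have "next_letter (zigzag T H k) A = T" if "even k"
      using that assms(2)
      by (intro next_letter_TT) (auto simp: last_zigzag successively_zigzag)
    ultimately show "next_letter (zigzag T H k) (if even k then A else zigzag H T n)
        = (if even k then T else H)" by simp
  qed
  \<comment> \<open>Deleting the leading \<open>T\<close> of the output leaves exactly Bob's string;
    this is the extra turn.\<close>
  have "sublist (zigzag H T n) (zigzag T H (Suc n))"
    by (simp add: zigzag_Suc_Cons sublist_Cons_right)
  then show ?thesis
    unfolding bob_wins_def using out noA by (intro exI[of _ "Suc n"]) (simp del: game_output.simps)
qed

theorem lemma21:
  fixes n :: nat and A B :: "coin list"
  assumes "n \<ge> 2"
    and "length A = n" and "length B = n"
    and "A \<noteq> B"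
  shows "(alternating A \<and> prefix [H] A \<and> prefix [T, T] B \<longrightarrow> alice_wins A B) \<and>
         (alternating B \<and> prefix [H] B \<and> prefix [T, T] A \<longrightarrow> bob_wins A B)"
proof -
  have "n > 0" using assms(1) by simp
  then show ?thesis
    using alternating_eq_zigzag[of A] alternating_eq_zigzag[of B]
      alternating_alice_wins[of n B] alternating_bob_wins[of n A] assms(2,3) by metis
qed

end
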